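(* For every $n\ge2$ and every graph $G^*$ on $n$ vertices with at most one loop per vertex, \[\lambda_2(G^* )-\lambda_n(G^* )\le\frac{n}{\sqrt2},\] with equality if and only if $G^*$ is isomorphic to the $t$-blowup $P_4^*(t)$ of the closed path $P_4^*$ for some positive integer $t$ (so $n=4t$). In particular, $s_{1,0}=\frac1{\sqrt2}$.
   Context: A graph with at most one loop per vertex on vertex set $\{1,\dots,n\}$ is identified with its adjacency matrix $A=(a_{uv})$, a symmetric $n\times n$ $(0,1)$-matrix where $a_{uv}=1$ iff $uv$ is an edge and $a_{uu}=1$ iff there is a loop at $u$. Its eigenvalues are listed as $\lambda_1\ge\cdots\ge\lambda_n$. The closed path $P_4^*$ is the path $v_1v_2v_3v_4$ with a loop at each of the two endpoints $v_1,v_4$ and no loops at $v_2,v_3$; its adjacency matrix is $\begin{pmatrix}1&1&0&0\\1&0&1&0\\0&1&0&1\\0&0&1&1\end{pmatrix}$. The $t$-blowup $G^*(t)$ of a graph $G^*$ with adjacency matrix $A$ is the graph with adjacency matrix $A\otimes J_t$, where $J_t$ is the $t\times t$ all-ones matrix. For a simple graph $G$ on $n$ vertices, ${\rm spread}_{i,j}(G)=\lambda_{i+1}(G)-\lambda_{n-j}(G)$; ${\rm spread}_{i,j}(n)$ is its maximum over simple graphs on $n$ vertices and $s_{i,j}=\lim_{n\to\infty}{\rm spread}_{i,j}(n)/n$ (known to exist). *)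

theory Defs
  imports "Jordan_Normal_Form.Char_Poly" "HOL-Computational_Algebra.Polynomial"
begin

text \<open>Graphs with at most one loop per vertex on n vertices (indices 0..n-1),
  identified with symmetric (0,1) adjacency matrices.\<close>
definition adj01 :: "nat \<Rightarrow> real mat \<Rightarrow> bool" where
  "adj01 n A \<longleftrightarrow> A \<in> carrier_mat n n \<and> A = transpose_mat A \<and>
     (\<forall>i<n. \<forall>j<n. A $$ (i,j) = 0 \<or> A $$ (i,j) = 1)"

definition simple_adj :: "nat \<Rightarrow> real mat \<Rightarrow> bool" where
  "simple_adj n A \<longleftrightarrow> adj01 n A \<and> (\<forall>i<n. A $$ (i,i) = 0)"

text \<open>Eigenvalues with multiplicity (roots of the characteristic polynomial),
  listed in non-increasing order; eig A k is lambda_k (1-indexed).\<close>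
definition eigs :: "real mat \<Rightarrow> real list" where
  "eigs A = rev (sorted_list_of_multiset (proots (char_poly A)))"

definition eig :: "real mat \<Rightarrow> nat \<Rightarrow> real" where
  "eig A k = eigs A ! (k - 1)"

definition P4star :: "real mat" where
  "P4star = mat_of_rows_list 4 [[1,1,0,0],[1,0,1,0],[0,1,0,1],[0,0,1,1]]"

text \<open>t-blowup: adjacency matrix M \<otimes> J_t.\<close>
definition blowup :: "real mat \<Rightarrow> nat \<Rightarrow> real mat" where
  "blowup M t = mat (dim_row M * t) (dim_col M * t) (\<lambda>(i,j). M $$ (i div t, j div t))"

definition graph_iso :: "nat \<Rightarrow> real mat \<Rightarrow> real mat \<Rightarrow> bool" where
  "graph_iso n A B \<longleftrightarrow> A \<in> carrier_mat n n \<and> B \<in> carrier_mat n n \<and>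
     (\<exists>\<sigma>. bij_betw \<sigma> {..<n} {..<n} \<and> (\<forall>i<n. \<forall>j<n. A $$ (\<sigma> i, \<sigma> j) = B $$ (i,j)))"

definition spread :: "nat \<Rightarrow> nat \<Rightarrow> nat \<Rightarrow> real mat \<Rightarrow> real" where
  "spread i j n A = eig A (i+1) - eig A (n - j)"

definition spread_max :: "nat \<Rightarrow> nat \<Rightarrow> nat \<Rightarrow> real" where
  "spread_max i j n = Max {spread i j n A | A. simple_adj n A}"

end

theory Submission
  imports Defs "Jordan_Normal_Form.Schur_Decomposition"
begin

text \<open>
  The squares of the eigenvalues add up to the number of ones of \<open>A\<close>, which is the value of the
  quadratic form of \<open>A\<close> at the all-ones vector and hence at most \<open>n \<lambda>\<^sub>1\<close>. Therefore
  \<open>\<lambda>\<^sub>2\<^sup>2 + \<lambda>\<^sub>n\<^sup>2 \<le> \<lambda>\<^sub>1 (n - \<lambda>\<^sub>1) \<le> n\<^sup>2 / 4\<close>, and \<open>\<lambda>\<^sub>2 - \<lambda>\<^sub>n \<le> n / \<surd>2\<close> follows.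

  In the case of equality \<open>\<lambda>\<^sub>1 = n / 2\<close>, the all-ones vector is an eigenvector, and all eigenvalues
  other than \<open>\<lambda>\<^sub>1, \<lambda>\<^sub>2, \<lambda>\<^sub>n\<close> vanish, so that \<open>2 A - J\<close> is a sign matrix of rank two with zero
  row sums and trace zero. Up to sign such a matrix has only two different rows, told apart by their
  diagonal entries; this splits the vertices into four classes, of equal size by the conditions on row
  sums and trace, with the adjacencies of \<open>P\<^sub>4\<^sup>*\<close>.

  The converse and the lower bound for the limit come from the Rayleigh principle applied to the
  eigenvectors of \<open>P\<^sub>4\<^sup>*\<close>, lifted to the blowup; deleting the loops changes \<open>\<lambda>\<^sub>2\<close> by at most 1.
\<close>

section \<open>Spectral theorem for real symmetric matrices\<close>

text \<open>The Hermitian form \<open>S\<close> of \<open>A\<close> at an eigenvector is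
  \<open>a\<close> times the squared norm \<open>N\<close>. Real symmetric entries make
  \<open>S\<close> its own conjugate, and \<open>N\<close> is nonzero.\<close>

lemma symmetric_mat_complex_eigenvalue_real:
  fixes A :: "real mat"
  assumes A: "A \<in> carrier_mat n n" and sym: "A = transpose_mat A"
    and ev: "eigenvalue (map_mat complex_of_real A) a"
  shows "a \<in> \<real>"
proof -
  let ?M = "map_mat complex_of_real A"
  from ev A obtain v where v: "v \<in> carrier_vec n" "v \<noteq> 0\<^sub>v n" "?M *\<^sub>v v = a \<cdot>\<^sub>v v"
    unfolding eigenvalue_def eigenvector_def by auto
  have symA: "A $$ (i, j) = A $$ (j, i)" if "i < n" "j < n" for i j
    using sym A that by (metis carrier_matD index_transpose_mat(1))
  have row: "(\<Sum>j<n. A $$ (i, j) * v $ j) = a * v $ i" if i: "i < n" for i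
  proof -
    have "(?M *\<^sub>v v) $ i = (\<Sum>j<n. A $$ (i, j) * v $ j)"
      using i A v(1) by (auto simp: scalar_prod_def lessThan_atLeast0)
    then show ?thesis using v i by simp
  qed
  define N where "N = (\<Sum>i<n. (cmod (v $ i))\<^sup>2)"
  define S where "S = (\<Sum>i<n. \<Sum>j<n. A $$ (i, j) * v $ j * cnj (v $ i))"
  have "S = (\<Sum>i<n. a * v $ i * cnj (v $ i))"
    unfolding S_def by (intro sum.cong refl) (simp add: row[symmetric] sum_distrib_right)
  also have "\<dots> = a * complex_of_real N"
    by (simp add: N_def sum_distrib_left complex_norm_square mult.assoc del: of_real_power)
  finally have S: "S = a * complex_of_real N" .
  have "cnj S = (\<Sum>i<n. \<Sum>j<n. A $$ (i, j) * cnj (v $ j) * v $ i)"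
    by (simp add: S_def)
  also have "\<dots> = (\<Sum>j<n. \<Sum>i<n. A $$ (i, j) * cnj (v $ j) * v $ i)"
    by (rule sum.swap)
  also have "\<dots> = S" unfolding S_def
    by (intro sum.cong refl) (simp add: symA mult_ac)
  finally have "cnj a * complex_of_real N = a * complex_of_real N" using S by simp
  moreover have "N \<noteq> 0"
  proof
    assume "N = 0"
    then have "\<forall>i<n. v $ i = 0" unfolding N_def by (subst (asm) sum_nonneg_eq_0_iff) auto
    then show False using v(1,2) by (auto simp: vec_eq_iff)
  qed
  ultimately have "cnj a = a" by simp
  then show ?thesis by (simp add: Reals_cnj_iff)
qed

text \<open>The polynomial splits over the complex numbers and all its roots are real; the
  factorization descends because the embedding of real polynomials is injective.\<close>

lemma symmetric_mat_char_poly_splits: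
  fixes A :: "real mat"
  assumes A: "A \<in> carrier_mat n n" and sym: "A = transpose_mat A"
  shows "\<exists>es. char_poly A = (\<Prod>e\<leftarrow>es. [:- e, 1:])"
proof -
  let ?M = "map_mat complex_of_real A"
  have M: "?M \<in> carrier_mat n n" using A by auto
  obtain as where as: "char_poly ?M = (\<Prod>a\<leftarrow>as. [:- a, 1:])"
    using char_poly_factorized[OF M] by blast
  have real: "a \<in> \<real>" if "a \<in> set as" for a
  proof (rule symmetric_mat_complex_eigenvalue_real[OF A sym])
    show "eigenvalue ?M a"
      unfolding eigenvalue_root_char_poly[OF M] as using that
      by (simp add: poly_prod_list prod_list_zero_iff image_iff)
  qed
  interpret rp: map_poly_inj_comm_ring_hom complex_of_real ..
  have "map_poly complex_of_real (char_poly A) = char_poly ?M"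
    by (rule of_real_hom.char_poly_hom[OF A, symmetric])
  also have "\<dots> = (\<Prod>a\<leftarrow>as. map_poly complex_of_real [:- Re a, 1:])"
    unfolding as using real by (intro arg_cong[of _ _ prod_list] map_cong) auto
  also have "\<dots> = map_poly complex_of_real (\<Prod>e\<leftarrow>map Re as. [:- e, 1:])"
    by (simp add: rp.hom_prod_list o_def)
  finally have "char_poly A = (\<Prod>e\<leftarrow>map Re as. [:- e, 1:])" by (rule rp.injectivity)
  then show ?thesis by blast
qed

text \<open>Gram-Schmidt applied to a basis beginning with \<open>v\<close> keeps \<open>v\<close>
  in front but yields only orthogonal vectors; the factors \<open>c i\<close> normalize
  them.\<close>

lemma orthonormal_completion:
  fixes v :: "real vec"
  assumes v: "v \<in> carrier_vec n" "v \<noteq> 0\<^sub>v n"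
  shows "\<exists>W c. W \<in> carrier_mat n n \<and> transpose_mat W * W = 1\<^sub>m n \<and> col W 0 = c \<cdot>\<^sub>v v"
proof -
  interpret cof_vec_space n "TYPE(real)" .
  define b where "b = basis_completion v"
  define ws where "ws = gram_schmidt n b"
  from basis_completion[OF v, folded b_def]
  have dist_b: "distinct b" and indep: "\<not> lin_dep (set b)" and b: "set b \<subseteq> carrier_vec n"
    and hdb: "hd b = v" and len_b: "length b = n" by auto
  have n: "n > 0"
    using v by (metis carrier_vecD eq_vecI gr0I index_zero_vec(2) less_nat_zero_code)
  from hdb len_b n obtain vs where bv: "b = v # vs" by (cases b) auto
  from gram_schmidt_result[OF b dist_b indep refl, folded ws_def]
  have ws: "set ws \<subseteq> carrier_vec n" "corthogonal ws" "length ws = n" by (auto simp: len_b)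
  from gram_schmidt_hd[OF v(1), of vs, folded bv] have hdws: "hd ws = v" unfolding ws_def .
  have ws0: "ws ! 0 = v" using hdws ws(3) n by (metis hd_conv_nth length_0_conv less_irrefl)
  have wsc: "ws ! i \<in> carrier_vec n" if "i < n" for i using ws that by auto
  have orth: "(ws ! i \<bullet> ws ! j = 0) = (i \<noteq> j)" if "i < n" "j < n" for i j
    using corthogonalD[OF ws(2), of i j] that ws(3) by simp
  have pos: "ws ! i \<bullet> ws ! i > 0" if "i < n" for i
    using orth[OF that that] by (simp add: scalar_prod_def order_less_le sum_nonneg)
  define c where "c i = inverse (sqrt (ws ! i \<bullet> ws ! i))" for i
  define W where "W = mat_of_cols n (map (\<lambda>i. c i \<cdot>\<^sub>v ws ! i) [0..<n])"
  have W: "W \<in> carrier_mat n n" unfolding W_def by auto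
  have col: "col W i = c i \<cdot>\<^sub>v ws ! i" if "i < n" for i
    unfolding W_def using that wsc[OF that] by (subst col_mat_of_cols) auto
  have "transpose_mat W * W = 1\<^sub>m n"
  proof (rule eq_matI)
    fix i j assume "i < dim_row (1\<^sub>m n)" "j < dim_col (1\<^sub>m n)"
    then have ij: "i < n" "j < n" by auto
    have "(transpose_mat W * W) $$ (i, j) = c i * c j * (ws ! i \<bullet> ws ! j)"
      using ij W col[OF ij(1)] col[OF ij(2)] wsc[OF ij(1)] wsc[OF ij(2)] by simp
    also have "\<dots> = 1\<^sub>m n $$ (i, j)"
    proof (cases "i = j")
      case True
      then show ?thesis using pos[OF ij(1)] ij
        by (simp add: c_def field_simps flip: real_sqrt_mult)
    next
      case False
      then show ?thesis using orth[OF ij] ij by simp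
    qed
    finally show "(transpose_mat W * W) $$ (i, j) = 1\<^sub>m n $$ (i, j)" .
  qed (use W in auto)
  then show ?thesis using W col[OF n] ws0 by blast
qed

text \<open>Deflation: an orthonormal basis beginning with an eigenvector for the first root splits
  off a one-by-one block and leaves a symmetric block with the remaining roots. Since
  \<open>es\<close> is prescribed, the diagonal can later be taken in the order of
  \<open>eigs A\<close>.\<close>

lemma symmetric_mat_diagonalization:
  fixes A :: "real mat"
  assumes "A \<in> carrier_mat n n" and "A = transpose_mat A"
    and "char_poly A = (\<Prod>e\<leftarrow>es. [:- e, 1:])"
  shows "\<exists>U. U \<in> carrier_mat n n \<and> transpose_mat U * U = 1\<^sub>m n \<and>
    transpose_mat U * A * U = mat n n (\<lambda>(i, j). if i = j then es ! i else 0)"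
  using assms
proof (induction es arbitrary: n A)
  case Nil
  then have "n = 0" using degree_monic_char_poly[OF Nil(1)] by simp
  then show ?case using Nil(1) by (intro exI[of _ "1\<^sub>m 0"]) auto
next
  case (Cons e es n A)
  note A = Cons.prems(1)
  have cp: "char_poly A = [:- e, 1:] * (\<Prod>e\<leftarrow>es. [:- e, 1:])" using Cons.prems(3) by simp
  then have "eigenvalue A e" unfolding eigenvalue_root_char_poly[OF A] by simp
  then obtain v where v: "v \<in> carrier_vec n" "v \<noteq> 0\<^sub>v n" "A *\<^sub>v v = e \<cdot>\<^sub>v v"
    using A unfolding eigenvalue_def eigenvector_def by auto
  have "n > 0"
    using v by (metis carrier_vecD eq_vecI gr0I index_zero_vec(2) less_nat_zero_code)
  then obtain m where n: "n = Suc m" by (cases n) auto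
  obtain W c where W: "W \<in> carrier_mat n n" and WW: "transpose_mat W * W = 1\<^sub>m n"
    and W0: "col W 0 = c \<cdot>\<^sub>v v" using orthonormal_completion[OF v(1,2)] by blast
  have WW': "W * transpose_mat W = 1\<^sub>m n"
    using mat_mult_left_right_inverse[OF _ W WW] W by auto
  define A' where "A' = transpose_mat W * A * W"
  have A': "A' \<in> carrier_mat n n" using W A by (simp add: A'_def)
  have symA': "transpose_mat A' = A'"
  proof -
    have "transpose_mat A' = transpose_mat W * (transpose_mat A * W)"
      unfolding A'_def using W A by (simp add: transpose_mult[of _ n n _ n])
    then show ?thesis using W A Cons.prems(2) by (simp add: A'_def assoc_mult_mat[of _ n n _ n _ n])
  qed
  \<comment> \<open>\<open>col W 0\<close> is a multiple of the eigenvector \<open>v\<close>, so the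
    first column of \<open>A * W\<close> is \<open>e\<close> times \<open>col W 0\<close>, which is
    orthogonal to all other columns of \<open>W\<close>.\<close>
  have A'0: "A' $$ (i, 0) = (if i = 0 then e else 0)" if i: "i < n" for i
  proof -
    have "col (A * W) 0 = e \<cdot>\<^sub>v col W 0"
      unfolding col_mult2[OF A W \<open>n > 0\<close>] W0 mult_mat_vec[OF A v(1)] v(3) smult_smult_assoc
      by (simp only: mult.commute)
    then have "A' $$ (i, 0) = col W i \<bullet> (e \<cdot>\<^sub>v col W 0)"
      using W A i \<open>n > 0\<close> by (simp add: A'_def assoc_mult_mat[of _ n n _ n _ n])
    also have "\<dots> = e * (transpose_mat W * W) $$ (i, 0)"
      using W i \<open>n > 0\<close> by (simp add: scalar_prod_smult_distrib[of _ n])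
    finally show ?thesis using WW i \<open>n > 0\<close> by simp
  qed
  have A'0': "A' $$ (0, i) = (if i = 0 then e else 0)" if i: "i < n" for i
    using A'0[OF i] symA' A' i \<open>n > 0\<close> by (metis carrier_matD index_transpose_mat(1))
  define A1 where "A1 = mat 1 1 (\<lambda>_. e)"
  define A3 where "A3 = mat m m (\<lambda>(i, j). A' $$ (Suc i, Suc j))"
  have A1: "A1 \<in> carrier_mat 1 1" and A3: "A3 \<in> carrier_mat m m" by (auto simp: A1_def A3_def)
  have blk: "A' = four_block_mat A1 (0\<^sub>m 1 m) (0\<^sub>m m 1) A3"
    by (rule eq_matI) (use A' n A'0 A'0' in \<open>auto simp: A1_def A3_def\<close>)
  have symA3: "A3 = transpose_mat A3"
  proof (rule eq_matI)
    fix i j assume "i < dim_row (transpose_mat A3)" "j < dim_col (transpose_mat A3)"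
    then have "i < m" "j < m" by (auto simp: A3_def)
    moreover have "A' $$ (Suc i, Suc j) = A' $$ (Suc j, Suc i)"
      using symA' A' n \<open>i < m\<close> \<open>j < m\<close> by (metis Suc_less_eq carrier_matD index_transpose_mat(1))
    ultimately show "A3 $$ (i, j) = transpose_mat A3 $$ (i, j)" by (simp add: A3_def)
  qed (auto simp: A3_def)
  have "similar_mat_wit A' A (transpose_mat W) W"
    by (rule similar_mat_witI[of _ _ n]) (use W A A' WW WW' in \<open>auto simp: A'_def\<close>)
  then have "char_poly A' = char_poly A"
    by (intro char_poly_similar) (auto simp: similar_mat_def)
  moreover have "char_poly A' = char_poly A1 * char_poly A3"
    unfolding blk by (rule char_poly_four_block_zeros_col[OF A1 _ A3]) simp
  moreover have "char_poly A1 = [:- e, 1:]"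
    by (simp add: A1_def char_poly_defs det_def sign_def)
  ultimately have "char_poly A3 = (\<Prod>e\<leftarrow>es. [:- e, 1:])"
    using cp by (metis mult_cancel_left pCons_eq_0_iff zero_neq_one)
  from Cons.IH[OF A3 symA3 this] obtain V where V: "V \<in> carrier_mat m m"
    and VV: "transpose_mat V * V = 1\<^sub>m m"
    and VAV: "transpose_mat V * A3 * V = mat m m (\<lambda>(i, j). if i = j then es ! i else 0)"
    by blast
  \<comment> \<open>A corner entry 1 extends \<open>V\<close> to the whole space and leaves the
    coordinate already split off untouched.\<close>
  define X where "X = four_block_mat (1\<^sub>m 1) (0\<^sub>m 1 m) (0\<^sub>m m 1) V"
  have X: "X \<in> carrier_mat n n"
    unfolding X_def n using four_block_carrier_mat[OF one_carrier_mat[of 1] V] by simp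
  have Xt: "transpose_mat X = four_block_mat (1\<^sub>m 1) (0\<^sub>m 1 m) (0\<^sub>m m 1) (transpose_mat V)"
    unfolding X_def using V by (subst transpose_four_block_mat[of _ 1 1 _ m _ m]) auto
  have XX: "transpose_mat X * X = 1\<^sub>m n"
    unfolding Xt unfolding X_def using V VV n
    by (subst mult_four_block_mat[of _ 1 1 _ m _ m _ _ 1 _ m]) auto
  have "transpose_mat X * A' = four_block_mat A1 (0\<^sub>m 1 m) (0\<^sub>m m 1) (transpose_mat V * A3)"
    unfolding Xt blk using V A1 A3
    by (subst mult_four_block_mat[of _ 1 1 _ m _ m _ _ 1 _ m]) auto
  then have "transpose_mat X * A' * X =
      four_block_mat A1 (0\<^sub>m 1 m) (0\<^sub>m m 1) (transpose_mat V * A3 * V)"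
    unfolding X_def using V A1 A3
    by (simp, subst mult_four_block_mat[of _ 1 1 _ m _ m _ _ 1 _ m]) auto
  also have "\<dots> = mat n n (\<lambda>(i, j). if i = j then (e # es) ! i else 0)"
    unfolding VAV by (rule eq_matI) (auto simp: n A1_def nth_Cons')
  finally have XAX: "transpose_mat X * A' * X = mat n n (\<lambda>(i, j). if i = j then (e # es) ! i else 0)" .
  let ?U = "W * X"
  have Ut: "transpose_mat ?U = transpose_mat X * transpose_mat W"
    using W X by (simp add: transpose_mult[of _ n n _ n])
  have "transpose_mat ?U * ?U = transpose_mat X * (transpose_mat W * W) * X"
    unfolding Ut using W X by (simp add: assoc_mult_mat[of _ n n _ n _ n])
  then have "transpose_mat ?U * ?U = 1\<^sub>m n" using WW XX X by simp
  moreover have "transpose_mat ?U * A * ?U = transpose_mat X * A' * X"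
    unfolding Ut A'_def using W X A by (simp add: assoc_mult_mat[of _ n n _ n _ n])
  ultimately show ?case using W X XAX by (intro exI[of _ ?U]) auto
qed

section \<open>The ordered list of eigenvalues and its eigenbasis\<close>

lemma mset_eigs: "mset (eigs A) = proots (char_poly A)"
  by (simp add: eigs_def)

text \<open>Some list of roots exists by splitting; \<open>eigs A\<close> has the same multiset, and
  a product of linear factors does not depend on their order. Comparing degrees gives the
  length.\<close>

lemma symmetric_mat_char_poly_eigs:
  fixes A :: "real mat"
  assumes A: "A \<in> carrier_mat n n" and sym: "A = transpose_mat A"
  shows "char_poly A = (\<Prod>e\<leftarrow>eigs A. [:- e, 1:])" and "length (eigs A) = n"
proof -
  obtain es where es: "char_poly A = (\<Prod>e\<leftarrow>es. [:- e, 1:])"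
    using symmetric_mat_char_poly_splits[OF assms] by blast
  have "proots (\<Prod>e\<leftarrow>es. [:- e, 1:]) = mset es"
    
  proof (induction es)
    case (Cons a es)
    have "(\<Prod>e\<leftarrow>es. [:- e, 1:]) \<noteq> 0" by (auto simp: prod_list_zero_iff)
    then have "proots ([:- a, 1:] * (\<Prod>e\<leftarrow>es. [:- e, 1:])) = {#a#} + proots (\<Prod>e\<leftarrow>es. [:- e, 1:])"
      by (subst proots_mult) (auto simp del: mult_pCons_left)
    then show ?case using Cons.IH by (simp del: mult_pCons_left)
  qed simp
  then have eq: "mset (eigs A) = mset es" by (simp add: mset_eigs es)
  have "(\<Prod>e\<leftarrow>xs. [:- e, 1:]) = prod_mset (image_mset (\<lambda>e. [:- e, 1:]) (mset xs))" for xs :: "real list"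
    by (simp flip: prod_mset_prod_list)
  then show 1: "char_poly A = (\<Prod>e\<leftarrow>eigs A. [:- e, 1:])" by (simp add: es eq)
  show "length (eigs A) = n"
    using degree_linear_factors[of uminus "eigs A"] degree_monic_char_poly[OF A] 1 by simp
qed

lemma eigs_antimono:
  assumes "i \<le> j" "j < length (eigs A)"
  shows "eigs A ! j \<le> eigs A ! i"
proof -
  have "sorted (rev (eigs A))" by (simp add: eigs_def)
  then have "sorted_wrt (\<ge>) (eigs A)" by (simp add: sorted_wrt_rev)
  then show ?thesis using assms sorted_wrt_nth_less[of "(\<ge>)" "eigs A" i j]
    by (cases "i = j") auto
qed

text \<open>\<open>A = U D U^T\<close> written entry by entry. The rows of \<open>U\<close> are
  orthonormal along with its columns because a one-sided inverse of a square matrix is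
  two-sided.\<close>

lemma symmetric_mat_spectral:
  fixes A :: "real mat"
  assumes A: "A \<in> carrier_mat n n" and sym: "A = transpose_mat A"
  obtains u :: "nat \<Rightarrow> nat \<Rightarrow> real" where
    "\<And>i j. i < n \<Longrightarrow> j < n \<Longrightarrow> (\<Sum>k<n. u k i * u k j) = (if i = j then 1 else 0)"
    "\<And>k l. k < n \<Longrightarrow> l < n \<Longrightarrow> (\<Sum>i<n. u k i * u l i) = (if k = l then 1 else 0)"
    "\<And>k l. k < n \<Longrightarrow> l < n \<Longrightarrow> A $$ (k, l) = (\<Sum>i<n. eigs A ! i * u k i * u l i)"
proof -
  let ?D = "mat n n (\<lambda>(i, j). if i = j then eigs A ! i else 0)"
  obtain U where U: "U \<in> carrier_mat n n" and UU: "transpose_mat U * U = 1\<^sub>m n"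
    and UAU: "transpose_mat U * A * U = ?D"
    using symmetric_mat_diagonalization[OF assms symmetric_mat_char_poly_eigs(1)[OF assms]] by blast
  have UU': "U * transpose_mat U = 1\<^sub>m n"
    using mat_mult_left_right_inverse[OF _ U UU] U by auto
  have "U * (transpose_mat U * A * U) * transpose_mat U = (U * transpose_mat U) * A * (U * transpose_mat U)"
    using U A by (simp add: assoc_mult_mat[of _ n n _ n _ n])
  then have AD: "A = U * ?D * transpose_mat U" using UAU UU' A by simp
  show ?thesis
  proof
    fix i j assume ij: "i < n" "j < n"
    have "(transpose_mat U * U) $$ (i, j) = (\<Sum>k<n. U $$ (k, i) * U $$ (k, j))"
      using ij U by (simp add: scalar_prod_def lessThan_atLeast0)
    then show "(\<Sum>k<n. U $$ (k, i) * U $$ (k, j)) = (if i = j then 1 else 0)" using UU ij by simp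
    have "(U * transpose_mat U) $$ (i, j) = (\<Sum>k<n. U $$ (i, k) * U $$ (j, k))"
      using ij U by (simp add: scalar_prod_def lessThan_atLeast0)
    then show "(\<Sum>k<n. U $$ (i, k) * U $$ (j, k)) = (if i = j then 1 else 0)" using UU' ij by simp
    have UD: "(U * ?D) $$ (i, k) = eigs A ! k * U $$ (i, k)" if "k < n" for k
      using that ij U by (simp add: scalar_prod_def lessThan_atLeast0 if_distrib cong: if_cong)
    have "(U * ?D * transpose_mat U) $$ (i, j) = (\<Sum>k<n. (U * ?D) $$ (i, k) * U $$ (j, k))"
      using ij U by (simp add: scalar_prod_def lessThan_atLeast0 del: index_mult_mat(1)) (simp add: scalar_prod_def)
    then show "A $$ (i, j) = (\<Sum>k<n. eigs A ! k * U $$ (i, k) * U $$ (j, k))"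
      using AD UD by simp
  qed
qed


section \<open>Rayleigh quotients\<close>

text \<open>Entry \<open>u k i\<close> is coordinate \<open>k\<close> of eigenvector
  \<open>i\<close>. Indices start at 0, so \<open>e 0\<close>, \<open>e 1\<close> and
  \<open>e (n - 1)\<close> are \<open>\<lambda>\<^sub>1\<close>, \<open>\<lambda>\<^sub>2\<close>
  and \<open>\<lambda>\<^sub>n\<close>.\<close>

locale spectral_decomposition =
  fixes n :: nat and a :: "nat \<Rightarrow> nat \<Rightarrow> real" and e :: "nat \<Rightarrow> real" and u :: "nat \<Rightarrow> nat \<Rightarrow> real"
  assumes cols_orthonormal:
      "\<And>i j. i < n \<Longrightarrow> j < n \<Longrightarrow> (\<Sum>k<n. u k i * u k j) = (if i = j then 1 else 0)"
    and rows_orthonormal: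
      "\<And>k l. k < n \<Longrightarrow> l < n \<Longrightarrow> (\<Sum>i<n. u k i * u l i) = (if k = l then 1 else 0)"
    and decomposition: "\<And>k l. k < n \<Longrightarrow> l < n \<Longrightarrow> a k l = (\<Sum>i<n. e i * u k i * u l i)"
    and e_antimono: "\<And>i j. i \<le> j \<Longrightarrow> j < n \<Longrightarrow> e j \<le> e i"
begin

definition coord :: "(nat \<Rightarrow> real) \<Rightarrow> nat \<Rightarrow> real" where
  "coord x i = (\<Sum>k<n. u k i * x k)"

definition quad :: "(nat \<Rightarrow> real) \<Rightarrow> real" where
  "quad x = (\<Sum>k<n. \<Sum>l<n. a k l * x k * x l)"

lemma coord_square: "(coord x i)\<^sup>2 = (\<Sum>k<n. \<Sum>l<n. u k i * u l i * (x k * x l))"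
  by (simp add: coord_def power2_eq_square sum_product mult_ac)

lemma quad_eq: "quad x = (\<Sum>i<n. e i * (coord x i)\<^sup>2)"
proof -
  have "quad x = (\<Sum>k<n. \<Sum>l<n. \<Sum>i<n. e i * (u k i * u l i * (x k * x l)))"
    unfolding quad_def
    by (intro sum.cong refl) (simp add: decomposition sum_distrib_left sum_distrib_right mult_ac)
  also have "\<dots> = (\<Sum>k<n. \<Sum>i<n. \<Sum>l<n. e i * (u k i * u l i * (x k * x l)))"
    by (rule sum.cong[OF refl], rule sum.swap)
  also have "\<dots> = (\<Sum>i<n. \<Sum>k<n. \<Sum>l<n. e i * (u k i * u l i * (x k * x l)))"
    by (rule sum.swap)
  also have "\<dots> = (\<Sum>i<n. e i * (coord x i)\<^sup>2)"
    by (simp add: coord_square sum_distrib_left)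
  finally show ?thesis .
qed

lemma parseval: "(\<Sum>i<n. (coord x i)\<^sup>2) = (\<Sum>k<n. (x k)\<^sup>2)"
proof -
  have "(\<Sum>i<n. (coord x i)\<^sup>2) = (\<Sum>k<n. \<Sum>i<n. \<Sum>l<n. u k i * u l i * (x k * x l))"
    unfolding coord_square by (rule sum.swap)
  also have "\<dots> = (\<Sum>k<n. \<Sum>l<n. \<Sum>i<n. u k i * u l i * (x k * x l))"
    by (rule sum.cong[OF refl], rule sum.swap)
  also have "\<dots> = (\<Sum>k<n. \<Sum>l<n. (if k = l then x k * x l else 0))"
    by (intro sum.cong refl) (simp add: rows_orthonormal flip: sum_distrib_right)
  also have "\<dots> = (\<Sum>k<n. (x k)\<^sup>2)"
    by (simp add: power2_eq_square)
  finally show ?thesis .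
qed

lemma expansion:
  assumes "k < n"
  shows "x k = (\<Sum>i<n. coord x i * u k i)"
proof -
  have "(\<Sum>i<n. coord x i * u k i) = (\<Sum>i<n. \<Sum>l<n. u k i * u l i * x l)"
    by (simp add: coord_def sum_distrib_left sum_distrib_right mult_ac)
  also have "\<dots> = (\<Sum>l<n. \<Sum>i<n. u k i * u l i * x l)" by (rule sum.swap)
  also have "\<dots> = (\<Sum>l<n. (if k = l then x l else 0))"
    using assms by (intro sum.cong refl) (simp add: rows_orthonormal flip: sum_distrib_right)
  also have "\<dots> = x k" using assms by simp
  finally show ?thesis by simp
qed

lemma eigenvector:
  assumes "k < n" "j < n"
  shows "(\<Sum>l<n. a k l * u l j) = e j * u k j"
proof -
  have "(\<Sum>l<n. a k l * u l j) = (\<Sum>l<n. \<Sum>i<n. e i * u k i * (u l i * u l j))"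
    using assms by (intro sum.cong refl) (simp add: decomposition sum_distrib_left sum_distrib_right mult_ac)
  also have "\<dots> = (\<Sum>i<n. \<Sum>l<n. e i * u k i * (u l i * u l j))" by (rule sum.swap)
  also have "\<dots> = (\<Sum>i<n. (if i = j then e i * u k i else 0))"
    using assms by (intro sum.cong refl) (simp add: cols_orthonormal flip: sum_distrib_left)
  also have "\<dots> = e j * u k j" using assms by simp
  finally show ?thesis .
qed

text \<open>Both sides are the trace of \<open>A\<^sup>2\<close>: one factor \<open>a k l\<close> is
  expanded spectrally, and the other is absorbed by the eigenvector equation.\<close>

lemma frobenius: "(\<Sum>k<n. \<Sum>l<n. (a k l)\<^sup>2) = (\<Sum>j<n. (e j)\<^sup>2)"
proof -
  have "(\<Sum>k<n. \<Sum>l<n. (a k l)\<^sup>2) = (\<Sum>k<n. \<Sum>l<n. \<Sum>j<n. e j * u k j * (a k l * u l j))"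
  proof (intro sum.cong refl)
    fix k l assume "k \<in> {..<n}" "l \<in> {..<n}"
    then have "(a k l)\<^sup>2 = a k l * (\<Sum>j<n. e j * u k j * u l j)"
      using decomposition[of k l] by (simp add: power2_eq_square)
    then show "(a k l)\<^sup>2 = (\<Sum>j<n. e j * u k j * (a k l * u l j))"
      by (simp add: sum_distrib_left mult_ac)
  qed
  also have "\<dots> = (\<Sum>k<n. \<Sum>j<n. \<Sum>l<n. e j * u k j * (a k l * u l j))"
    by (rule sum.cong[OF refl], rule sum.swap)
  also have "\<dots> = (\<Sum>k<n. \<Sum>j<n. (e j)\<^sup>2 * (u k j * u k j))"
    by (intro sum.cong refl, subst sum_distrib_left[symmetric])
      (simp add: eigenvector power2_eq_square)
  also have "\<dots> = (\<Sum>j<n. \<Sum>k<n. (e j)\<^sup>2 * (u k j * u k j))" by (rule sum.swap)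
  also have "\<dots> = (\<Sum>j<n. (e j)\<^sup>2)"
    by (intro sum.cong refl) (simp add: cols_orthonormal flip: sum_distrib_left)
  finally show ?thesis .
qed

lemma last_eigenvalue_le:
  assumes "quad x \<le> c * (\<Sum>k<n. (x k)\<^sup>2)" "(\<Sum>k<n. (x k)\<^sup>2) > 0"
  shows "e (n - 1) \<le> c"
proof -
  have "e (n - 1) * (\<Sum>k<n. (x k)\<^sup>2) = (\<Sum>i<n. e (n - 1) * (coord x i)\<^sup>2)"
    by (subst parseval[symmetric]) (rule sum_distrib_left)
  also have "\<dots> \<le> quad x"
    unfolding quad_eq by (intro sum_mono mult_right_mono e_antimono) auto
  also note assms(1)
  finally show ?thesis using assms(2) by simp
qed

text \<open>One half of the Courant-Fischer principle: the plane spanned by \<open>x\<close> and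
  \<open>y\<close> contains a nonzero vector \<open>w\<close> orthogonal to eigenvector 0, and on
  such vectors the form is at most \<open>e 1\<close> times the squared norm.\<close>

lemma second_eigenvalue_ge:
  assumes "n \<ge> 2"
    and ge: "\<And>\<alpha> \<beta>. quad (\<lambda>k. \<alpha> * x k + \<beta> * y k) \<ge> c * (\<Sum>k<n. (\<alpha> * x k + \<beta> * y k)\<^sup>2)"
    and indep: "\<And>\<alpha> \<beta>. (\<Sum>k<n. (\<alpha> * x k + \<beta> * y k)\<^sup>2) = 0 \<Longrightarrow> \<alpha> = 0 \<and> \<beta> = 0"
  shows "e 1 \<ge> c"
proof -
  have lin: "coord (\<lambda>k. \<alpha> * x k + \<beta> * y k) i = \<alpha> * coord x i + \<beta> * coord y i" for \<alpha> \<beta> i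
    by (simp add: coord_def sum_distrib_left sum.distrib algebra_simps)
  obtain \<alpha> \<beta> where ab: "\<alpha> * coord x 0 + \<beta> * coord y 0 = 0" "\<alpha> \<noteq> 0 \<or> \<beta> \<noteq> 0"
  proof (cases "coord x 0 = 0")
    case True
    then show ?thesis using that[of 1 0] by simp
  next
    case False
    then show ?thesis using that[of "coord y 0" "- coord x 0"] by simp
  qed
  define w where "w = (\<lambda>k. \<alpha> * x k + \<beta> * y k)"
  have w0: "coord w 0 = 0" using ab lin by (simp add: w_def)
  have "(\<Sum>k<n. (w k)\<^sup>2) \<noteq> 0" using indep ab unfolding w_def by blast
  then have pos: "(\<Sum>k<n. (w k)\<^sup>2) > 0" by (simp add: sum_nonneg order_less_le)
  have "c * (\<Sum>k<n. (w k)\<^sup>2) \<le> quad w" using ge by (simp add: w_def)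
  also have "\<dots> \<le> (\<Sum>i<n. e 1 * (coord w i)\<^sup>2)"
    unfolding quad_eq
  proof (intro sum_mono)
    fix i assume "i \<in> {..<n}"
    then show "e i * (coord w i)\<^sup>2 \<le> e 1 * (coord w i)\<^sup>2"
      using w0 e_antimono[of 1 i] by (cases "i = 0") (auto intro: mult_right_mono)
  qed
  also have "\<dots> = e 1 * (\<Sum>k<n. (w k)\<^sup>2)" by (simp add: parseval flip: sum_distrib_left)
  finally show ?thesis using pos by simp
qed

end


section \<open>The upper bound\<close>

text \<open>Here \<open>x\<close>, \<open>y\<close>, \<open>z\<close> stand for
  \<open>\<lambda>\<^sub>1\<close>, \<open>\<lambda>\<^sub>2\<close>,
  \<open>\<lambda>\<^sub>n\<close> and \<open>R\<close> for the remaining squares. The defect in the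
  bound is a sum of nonnegative terms, so a single identity gives both the bound and the conditions
  for equality.\<close>

lemma square_gap:
  fixes N x y z R :: real
  assumes le: "x\<^sup>2 + y\<^sup>2 + z\<^sup>2 + R \<le> N * x" and R: "R \<ge> 0"
  shows "(y - z)\<^sup>2 \<le> N\<^sup>2 / 2"
    and "(y - z)\<^sup>2 = N\<^sup>2 / 2 \<Longrightarrow> x = N / 2 \<and> z = - y \<and> R = 0 \<and> x\<^sup>2 + y\<^sup>2 + z\<^sup>2 + R = N * x"
proof -
  define D where "D = N * x - (x\<^sup>2 + y\<^sup>2 + z\<^sup>2 + R)"
  \<comment> \<open>Once the squares have names, only linear arithmetic remains.\<close>
  define p where "p = (x - N / 2)\<^sup>2"
  define q where "q = (y + z)\<^sup>2"
  define g where "g = (y - z)\<^sup>2"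
  define M where "M = N\<^sup>2 / 2"
  have id: "M - g = 2 * p + q + 2 * R + 2 * D"
    by (simp add: M_def g_def p_def q_def D_def power2_eq_square field_simps)
  have nn: "D \<ge> 0" "p \<ge> 0" "q \<ge> 0" using le by (simp_all add: D_def p_def q_def)
  show "(y - z)\<^sup>2 \<le> N\<^sup>2 / 2" using id nn R by (simp flip: g_def M_def)
  assume "(y - z)\<^sup>2 = N\<^sup>2 / 2"
  then have "p = 0" "q = 0" "R = 0" "D = 0" using id nn R by (simp_all flip: g_def M_def)
  then show "x = N / 2 \<and> z = - y \<and> R = 0 \<and> x\<^sup>2 + y\<^sup>2 + z\<^sup>2 + R = N * x"
    by (auto simp: p_def q_def D_def)
qed

text \<open>With at least three vertices the indices 0, 1 and \<open>n - 1\<close> are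
  distinct.\<close>

locale graph_spectrum = spectral_decomposition +
  assumes n_ge_3: "n \<ge> 3"
    and entries: "\<And>k l. k < n \<Longrightarrow> l < n \<Longrightarrow> a k l = 0 \<or> a k l = 1"
begin

definition colsum :: "nat \<Rightarrow> real" where
  "colsum = coord (\<lambda>_. 1)"

text \<open>A 0/1 entry is its own square, so the Frobenius norm is the quadratic form at the
  all-ones vector.\<close>

lemma sum_squares_eigenvalues: "(\<Sum>j<n. (e j)\<^sup>2) = (\<Sum>j<n. e j * (colsum j)\<^sup>2)"
proof -
  have "(\<Sum>k<n. \<Sum>l<n. (a k l)\<^sup>2) = quad (\<lambda>_. 1)"
    unfolding quad_def by (intro sum.cong refl) (use entries in fastforce)
  then show ?thesis by (simp add: frobenius quad_eq colsum_def)
qed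

lemma sum_colsum_squares: "(\<Sum>j<n. (colsum j)\<^sup>2) = n"
  by (simp add: colsum_def parseval)

lemma sum_squares_le: "(\<Sum>j<n. (e j)\<^sup>2) \<le> n * e 0"
proof -
  have "(\<Sum>j<n. (e j)\<^sup>2) \<le> (\<Sum>j<n. e 0 * (colsum j)\<^sup>2)"
    unfolding sum_squares_eigenvalues by (intro sum_mono mult_right_mono e_antimono) auto
  then show ?thesis by (simp add: sum_colsum_squares mult.commute flip: sum_distrib_left)
qed

lemma sum_split:
  fixes h :: "nat \<Rightarrow> real"
  shows "(\<Sum>j<n. h j) = h 0 + h 1 + h (n - 1) + (\<Sum>j\<in>{2..<n - 1}. h j)"
proof -
  have "{..<n} = insert 0 (insert 1 (insert (n - 1) {2..<n - 1}))" using n_ge_3 by auto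
  then show ?thesis using n_ge_3 by simp
qed

lemma three_squares_le:
  "(e 0)\<^sup>2 + (e 1)\<^sup>2 + (e (n - 1))\<^sup>2 + (\<Sum>j\<in>{2..<n - 1}. (e j)\<^sup>2) \<le> n * e 0"
  using sum_squares_le sum_split[of "\<lambda>j. (e j)\<^sup>2"] by simp

lemma gap_square_le: "(e 1 - e (n - 1))\<^sup>2 \<le> (real n)\<^sup>2 / 2"
  by (rule square_gap(1)[OF three_squares_le]) (simp add: sum_nonneg)

lemma gap_le: "e 1 - e (n - 1) \<le> n / sqrt 2"
proof (rule power2_le_imp_le)
  show "(e 1 - e (n - 1))\<^sup>2 \<le> (n / sqrt 2)\<^sup>2" using gap_square_le by (simp add: power_divide)
qed simp

text \<open>In the case of equality eigenvector 0 is constant and contributes \<open>J / 2\<close>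
  to \<open>A\<close>; eigenvectors 1 and \<open>n - 1\<close> contribute with opposite eigenvalues,
  and the others with eigenvalue zero.\<close>

lemma extremal_form:
  assumes eq: "e 1 - e (n - 1) = n / sqrt 2"
  shows "\<And>k l. k < n \<Longrightarrow> l < n \<Longrightarrow>
      2 * a k l - 1 = n / sqrt 2 * (u k 1 * u l 1 - u k (n - 1) * u l (n - 1))"
    and "(\<Sum>k<n. u k 1) = 0" and "(\<Sum>k<n. u k (n - 1)) = 0"
proof -
  let ?R = "\<Sum>j\<in>{2..<n - 1}. (e j)\<^sup>2"
  have "(e 1 - e (n - 1))\<^sup>2 = (real n)\<^sup>2 / 2" unfolding eq by (simp add: power_divide)
  then have tight: "e 0 = n / 2 \<and> e (n - 1) = - e 1 \<and> ?R = 0 \<and>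
      (e 0)\<^sup>2 + (e 1)\<^sup>2 + (e (n - 1))\<^sup>2 + ?R = n * e 0"
    by (intro square_gap(2)[OF three_squares_le]) (simp_all add: sum_nonneg)
  then have e0: "e 0 = n / 2" and en: "e (n - 1) = - e 1" and R: "?R = 0" by blast+
  have e1: "2 * e 1 = n / sqrt 2" using eq en by simp
  have ej: "e j = 0" if "j \<in> {2..<n - 1}" for j
    using R that by (subst (asm) sum_nonneg_eq_0_iff) auto
  \<comment> \<open>The strict inequality gives every index except 0 a positive weight
    \<open>e 0 - e j\<close> in the sum below.\<close>
  have e1n: "e 1 < e 0"
  proof -
    have "1 < sqrt 2" by simp
    then have "n / sqrt 2 < n" using n_ge_3 by (simp add: divide_less_eq)
    then show ?thesis using e0 e1 by simp
  qed
  \<comment> \<open>Nonnegative terms with sum zero vanish one by one, so the all-ones vector is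
    orthogonal to every eigenvector except number 0.\<close>
  have "(\<Sum>j<n. (e 0 - e j) * (colsum j)\<^sup>2) = n * e 0 - (\<Sum>j<n. (e j)\<^sup>2)"
    by (simp add: sum_squares_eigenvalues sum_colsum_squares left_diff_distrib sum_subtractf mult.commute
        flip: sum_distrib_left)
  also have "(\<Sum>j<n. (e j)\<^sup>2) = n * e 0" using tight unfolding sum_split by blast
  finally have "(\<Sum>j<n. (e 0 - e j) * (colsum j)\<^sup>2) = 0" by simp
  then have cs: "\<forall>j<n. (e 0 - e j) * (colsum j)\<^sup>2 = 0"
    by (subst (asm) sum_nonneg_eq_0_iff) (auto intro!: mult_nonneg_nonneg e_antimono)
  have c0: "colsum j = 0" if "0 < j" "j < n" for j
    using cs that e1n e_antimono[of 1 j] by force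
  then show "(\<Sum>k<n. u k 1) = 0" "(\<Sum>k<n. u k (n - 1)) = 0"
    using n_ge_3 c0[of 1] c0[of "n - 1"] by (auto simp: colsum_def coord_def)
  have single: "(\<Sum>j<n. h j) = h 0" if "\<And>j. 0 < j \<Longrightarrow> j < n \<Longrightarrow> h j = 0" for h :: "nat \<Rightarrow> real"
    using sum.mono_neutral_right[of "{..<n}" "{0}" h] that n_ge_3 by auto
  have "(colsum 0)\<^sup>2 = n"
    using sum_colsum_squares single[of "\<lambda>j. (colsum j)\<^sup>2"] c0 by simp
  have const: "colsum 0 * u k 0 = 1" if "k < n" for k
  proof -
    have "1 = (\<Sum>i<n. colsum i * u k i)" using expansion[OF that, of "\<lambda>_. 1"] by (simp add: colsum_def)
    then show ?thesis using single[of "\<lambda>i. colsum i * u k i"] c0 by simp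
  qed
  have prod: "n * (u k 0 * u l 0) = 1" if "k < n" "l < n" for k l
  proof -
    have "n * (u k 0 * u l 0) = (colsum 0 * u k 0) * (colsum 0 * u l 0)"
      by (simp add: power2_eq_square mult_ac flip: \<open>(colsum 0)\<^sup>2 = n\<close>)
    then show ?thesis using const that by simp
  qed
  fix k l assume kl: "k < n" "l < n"
  have "a k l = e 0 * u k 0 * u l 0 + e 1 * u k 1 * u l 1 + e (n - 1) * u k (n - 1) * u l (n - 1)"
    unfolding decomposition[OF kl] sum_split[of "\<lambda>i. e i * u k i * u l i"]
    using sum.neutral[of "{2..<n - 1}" "\<lambda>i. e i * u k i * u l i"] ej by simp
  also have "\<dots> = (n * (u k 0 * u l 0)) / 2 + e 1 * (u k 1 * u l 1 - u k (n - 1) * u l (n - 1))"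
    unfolding e0 en by (simp add: algebra_simps)
  finally have "2 * a k l - 1 = (2 * e 1) * (u k 1 * u l 1 - u k (n - 1) * u l (n - 1))"
    using prod[OF kl] by (simp add: algebra_simps)
  then show "2 * a k l - 1 = n / sqrt 2 * (u k 1 * u l 1 - u k (n - 1) * u l (n - 1))"
    using e1 by simp
qed

end


section \<open>Sign matrices of rank two\<close>

text \<open>The cases are the middle edge, the two loops, and the two outer edges with index sums 1
  and 5.\<close>

lemma P4star_index:
  assumes "i < 4" "j < 4"
  shows "P4star $$ (i, j) = (if i + j = 3 \<and> i \<in> {1, 2} \<or> i = j \<and> i \<in> {0, 3} \<or> i + j = 1 \<or> i + j = 5 then 1 else 0)"
proof -
  have "i \<in> {0, 1, 2, 3}" "j \<in> {0, 1, 2, 3}" using assms by auto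
  then show ?thesis by (auto simp: P4star_def mat_of_rows_list_def)
qed

text \<open>A form of signature (1,1) is written through a pair of linear factors, which makes its
  diagonal \<open>f k * g k\<close>. Vertices are sorted by diagonal sign and by sign in the row of
  a fixed looped vertex \<open>p\<close>; the vanishing trace and row sums equalize the four
  classes.\<close>

lemma sign_matrix_rank_two:
  fixes f g :: "nat \<Rightarrow> real"
  defines "b \<equiv> \<lambda>k l. (f k * g l + g k * f l) / 2"
  assumes n: "n > 0"
    and sign: "\<And>k l. k < n \<Longrightarrow> l < n \<Longrightarrow> b k l = 1 \<or> b k l = -1"
    and sf: "(\<Sum>k<n. f k) = 0" and sg: "(\<Sum>k<n. g k) = 0" and sfg: "(\<Sum>k<n. f k * g k) = 0"
  shows "\<exists>t c. t > 0 \<and> n = 4 * t \<and> (\<forall>k<n. c k < 4) \<and> (\<forall>j<4. card {k. k < n \<and> c k = j} = t) \<and>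
    (\<forall>k<n. \<forall>l<n. b k l = 2 * P4star $$ (c k, c l) - 1)"
proof -
  have bsym: "b k l = b l k" for k l by (simp add: b_def mult.commute)
  have bkk: "b k k = f k * g k" for k by (simp add: b_def mult.commute)
  \<comment> \<open>For equal diagonal entries, \<open>(f k, g k)\<close> is
    \<open>(f l, g l)\<close> multiplied by the sign \<open>b k k * b k l\<close>.\<close>
  have row_eq: "b k m = b k k * b k l * b l m"
    if kl: "k < n" "l < n" and same: "b k k = b l l" for k l m
  proof -
    define s where "s = b k l"
    define d where "d = b k k"
    have s: "s * s = 1" and d: "d * d = 1" using sign[OF kl] sign[OF kl(1) kl(1)] by (auto simp: s_def d_def)
    have fk: "f k * g k = d" and fl: "f l * g l = d" using same bkk by (auto simp: d_def)
    \<comment> \<open>Two reals with sum \<open>2 s\<close> and product \<open>1 = s\<^sup>2\<close> are both equal to \<open>s\<close>.\<close>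
    have "(f k * g l - s)\<^sup>2 = 0"
    proof -
      have "f k * g l + g k * f l = 2 * s" by (simp add: s_def b_def)
      then have "g k * f l = 2 * s - f k * g l" by simp
      moreover have "(f k * g l) * (g k * f l) = (f k * g k) * (f l * g l)" by (simp add: mult_ac)
      ultimately have "(f k * g l) * (2 * s - f k * g l) = s * s" using fk fl d s by simp
      then show ?thesis by (simp add: power2_eq_square algebra_simps)
    qed
    then have fg: "f k * g l = s" by simp
    moreover have "f k * g l + g k * f l = 2 * s" by (simp add: s_def b_def)
    ultimately have gf: "g k * f l = s" by simp
    have "f k = d * d * f k" using d by simp
    also have "\<dots> = d * (f k * g l) * f l" using fl by (metis mult.assoc mult.commute)
    finally have 1: "f k = d * s * f l" using fg by simp
    have "g k = d * d * g k" using d by simp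
    also have "\<dots> = d * (g k * f l) * g l" using fl by (metis mult.assoc mult.commute)
    finally have 2: "g k = d * s * g l" using gf by simp
    have "b k m = d * s * b l m"
      unfolding b_def 1 2 by (simp add: algebra_simps)
    then show ?thesis by (simp add: s_def d_def)
  qed
  have trace: "(\<Sum>k<n. b k k) = 0" using sfg by (simp add: bkk)
  have rowsum: "(\<Sum>l<n. b k l) = 0" for k
  proof -
    have "(\<Sum>l<n. b k l) = (f k * (\<Sum>l<n. g l) + g k * (\<Sum>l<n. f l)) / 2"
      unfolding b_def sum_divide_distrib[symmetric] sum.distrib sum_distrib_left ..
    then show ?thesis using sf sg by simp
  qed
  obtain p where p: "p < n" "b p p = 1"
  proof -
    have "\<not> (\<forall>k<n. b k k = -1)"
    proof
      assume "\<forall>k<n. b k k = -1"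
      then have "(\<Sum>k<n. b k k) = (\<Sum>k<n. -1)" by (intro sum.cong) auto
      then show False using trace n by simp
    qed
    then show ?thesis using sign that by blast
  qed
  obtain q where q: "q < n" "b q q = -1"
  proof -
    have "\<not> (\<forall>k<n. b k k = 1)"
    proof
      assume "\<forall>k<n. b k k = 1"
      then have "(\<Sum>k<n. b k k) = (\<Sum>k<n. 1)" by (intro sum.cong) auto
      then show False using trace n by simp
    qed
    then show ?thesis using sign that by blast
  qed
  define s where "s k = b p k" for k
  have ss: "s k = 1 \<or> s k = -1" if "k < n" for k using sign[OF p(1) that] by (simp add: s_def)
  have pos: "b k l = s k * s l" if "k < n" "b k k = 1" for k l
    using row_eq[OF that(1) p(1), of l] that(2) p(2) bsym[of k p] by (simp add: s_def)
  have neg: "b k l = - (s k * s l)" if "k < n" "l < n" "b k k = -1" "b l l = -1" for k l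
  proof -
    have "s k = - (b k l * s l)"
      using row_eq[OF that(1,2), of p] that(3,4) bsym[of k p] bsym[of l p] by (simp add: s_def)
    then show ?thesis using ss[OF that(2)] by auto
  qed
  define P where "P = (\<lambda>x y. {k. k < n \<and> b k k = x \<and> s k = y})"
  have finP: "finite (P x y)" for x y by (simp add: P_def)
  have cards: "(\<Sum>k<n. h (b k k) (s k)) =
      h 1 1 * card (P 1 1) + h 1 (-1) * card (P 1 (-1)) + h (-1) 1 * card (P (-1) 1)
      + h (-1) (-1) * card (P (-1) (-1))" for h :: "real \<Rightarrow> real \<Rightarrow> real"
  proof -
    have "{..<n} = (P 1 1 \<union> P 1 (-1)) \<union> (P (-1) 1 \<union> P (-1) (-1))"
      using sign ss by (auto simp: P_def)
    moreover have "sum (\<lambda>k. h (b k k) (s k)) ((P 1 1 \<union> P 1 (-1)) \<union> (P (-1) 1 \<union> P (-1) (-1))) =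
        (sum (\<lambda>k. h (b k k) (s k)) (P 1 1) + sum (\<lambda>k. h (b k k) (s k)) (P 1 (-1)))
        + (sum (\<lambda>k. h (b k k) (s k)) (P (-1) 1) + sum (\<lambda>k. h (b k k) (s k)) (P (-1) (-1)))"
      by (subst sum.union_disjoint; (use finP in \<open>auto simp: P_def\<close>)?)+
    moreover have "sum (\<lambda>k. h (b k k) (s k)) (P x y) = h x y * card (P x y)" for x y
      by (simp add: P_def)
    ultimately show ?thesis by simp
  qed
  have 1: "(\<Sum>k<n. b k k) = 0" "(\<Sum>k<n. s k) = 0" using trace rowsum[of p] by (auto simp: s_def)
  \<comment> \<open>Up to the sign \<open>s q\<close>, the row of \<open>q\<close> is
    \<open>b k k * s k\<close>, so its zero sum is the third relation.\<close>
  have 2: "(\<Sum>k<n. b k k * s k) = 0"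
  proof -
    have "b q k = s q * (b k k * s k)" if "k < n" for k
      using sign[OF that that] pos[OF that, of q] neg[OF q(1) that q(2)] bsym[of q k] by auto
    then have "(\<Sum>k<n. b q k) = s q * (\<Sum>k<n. b k k * s k)" by (simp add: sum_distrib_left)
    then show ?thesis using rowsum[of q] ss[OF q(1)] by auto
  qed
  define t where "t = card (P 1 1)"
  \<comment> \<open>The sums of \<open>x\<close>, \<open>y\<close> and \<open>x * y\<close> over the
    sign pairs of all vertices vanish. These three relations among four class sizes leave only equal
    sizes.\<close>
  have eqs: "card (P 1 (-1)) = t" "card (P (-1) 1) = t" "card (P (-1) (-1)) = t"
    using 1 2 cards[of "\<lambda>x y. x"] cards[of "\<lambda>x y. y"] cards[of "\<lambda>x y. x * y"]
    by (simp_all add: t_def)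
  have n4: "n = 4 * t" using cards[of "\<lambda>x y. 1"] eqs t_def[symmetric] by simp
  \<comment> \<open>Numbering of the four classes along the path: the loops are at the ends.\<close>
  define c :: "nat \<Rightarrow> nat" where
    "c k = (if b k k = 1 then (if s k = 1 then 0 else 3) else (if s k = 1 then 1 else 2))" for k
  have fib: "{k. k < n \<and> c k = 0} = P 1 1" "{k. k < n \<and> c k = 1} = P (-1) 1"
    "{k. k < n \<and> c k = 2} = P (-1) (-1)" "{k. k < n \<and> c k = 3} = P 1 (-1)"
    using sign ss by (auto simp: P_def c_def split: if_splits)
  have "card {k. k < n \<and> c k = j} = t" if "j < 4" for j
  proof -
    have "j = 0 \<or> j = 1 \<or> j = 2 \<or> j = 3" using that by auto
    then show ?thesis using fib eqs t_def by auto
  qed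
  moreover have c4: "c k < 4" for k by (simp add: c_def)
  moreover have "b k l = 2 * P4star $$ (c k, c l) - 1" if kl: "k < n" "l < n" for k l
  proof -
    have "b k l = (if b k k = -1 \<and> b l l = -1 then - (s k * s l) else s k * s l)"
      using sign[OF kl(1) kl(1)] sign[OF kl(2) kl(2)] pos[OF kl(1), of l] pos[OF kl(2), of k]
        neg[OF kl] bsym[of k l] by auto
    then show ?thesis
      using sign[OF kl(1) kl(1)] sign[OF kl(2) kl(2)] ss[OF kl(1)] ss[OF kl(2)]
      unfolding P4star_index[OF c4 c4] by (auto simp: c_def)
  qed
  ultimately show ?thesis using n n4 by (intro exI[of _ t] exI[of _ c]) auto
qed

section \<open>Isomorphism with a blowup, expressed by colourings with equal classes\<close>

lemma equal_fibres_bij: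
  fixes c :: "nat \<Rightarrow> nat" and d :: "nat \<Rightarrow> nat"
  assumes "\<And>j. card {k. k < n \<and> c k = j} = card {k. k < n \<and> d k = j}"
  shows "\<exists>\<sigma>. bij_betw \<sigma> {..<n} {..<n} \<and> (\<forall>k<n. c (\<sigma> k) = d k)"
proof -
  have "\<exists>h. bij_betw h {k. k < n \<and> d k = j} {k. k < n \<and> c k = j}" for j
    by (rule finite_same_card_bij) (use assms in auto)
  then obtain h where h: "\<And>j. bij_betw (h j) {k. k < n \<and> d k = j} {k. k < n \<and> c k = j}" by metis
  define \<sigma> where "\<sigma> k = h (d k) k" for k
  have im: "\<sigma> k < n \<and> c (\<sigma> k) = d k" if "k < n" for k
    using bij_betwE[OF h[of "d k"]] that by (auto simp: \<sigma>_def)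
  have "inj_on \<sigma> {..<n}"
  proof (rule inj_onI)
    fix k l assume kl: "k \<in> {..<n}" "l \<in> {..<n}" "\<sigma> k = \<sigma> l"
    then have "d k = d l" using im by (metis lessThan_iff)
    then show "k = l"
      using inj_onD[OF bij_betw_imp_inj_on[OF h[of "d k"]], of k l] kl by (simp add: \<sigma>_def)
  qed
  then have "bij_betw \<sigma> {..<n} {..<n}"
    using endo_inj_surj[of "{..<n}" \<sigma>] im by (auto simp: bij_betw_def)
  then show ?thesis using im by auto
qed

lemma card_div_fibre:
  fixes t :: nat
  assumes "t > 0" "j < m"
  shows "card {k. k < m * t \<and> k div t = j} = t"
proof -
  have "{k. k < m * t \<and> k div t = j} = {j * t..<Suc j * t}"
  proof (rule Set.set_eqI)
    fix k
    have "Suc j * t \<le> m * t" using assms(2) by (intro mult_le_mono1) simp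
    moreover have "k div t = j \<longleftrightarrow> j * t \<le> k \<and> k < Suc j * t"
      using assms(1) by (metis div_nat_eqI dividend_less_div_times mult.commute mult_Suc times_div_less_eq_dividend add.commute)
    ultimately show "k \<in> {k. k < m * t \<and> k div t = j} \<longleftrightarrow> k \<in> {j * t..<Suc j * t}" by auto
  qed
  then show ?thesis by simp
qed

text \<open>The colour of a vertex is the path vertex of which it is a copy. An isomorphism colours
  by the block of the preimage; conversely, colour classes and blocks of equal size are matched by a
  permutation.\<close>

lemma graph_iso_blowup_P4star_iff:
  assumes A: "A \<in> carrier_mat n n" and t: "t > 0"
  shows "graph_iso n A (blowup P4star t) \<longleftrightarrow> n = 4 * t \<and>
    (\<exists>c. (\<forall>k<n. c k < 4) \<and> (\<forall>j<4. card {k. k < n \<and> c k = j} = t) \<and>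
      (\<forall>k<n. \<forall>l<n. A $$ (k, l) = P4star $$ (c k, c l)))" (is "?L \<longleftrightarrow> n = 4 * t \<and> (\<exists>c. ?R c)")
proof
  have dim: "dim_row P4star = 4" "dim_col P4star = 4" by (auto simp: P4star_def mat_of_rows_list_def)
  have bl: "blowup P4star t $$ (i, j) = P4star $$ (i div t, j div t)" if "i < 4 * t" "j < 4 * t" for i j
    using that dim by (simp add: blowup_def)
  {
    assume ?L
    then obtain \<sigma> where bij: "bij_betw \<sigma> {..<n} {..<n}"
      and \<sigma>: "\<And>i j. i < n \<Longrightarrow> j < n \<Longrightarrow> A $$ (\<sigma> i, \<sigma> j) = blowup P4star t $$ (i, j)"
      and bc: "blowup P4star t \<in> carrier_mat n n"
      unfolding graph_iso_def by blast
    have n: "n = 4 * t" using carrier_matD(1)[OF bc] by (simp add: blowup_def dim)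
    define \<tau> where "\<tau> = the_inv_into {..<n} \<sigma>"
    have bij\<tau>: "bij_betw \<tau> {..<n} {..<n}" unfolding \<tau>_def by (rule bij_betw_the_inv_into[OF bij])
    have \<tau>: "\<tau> k < n" "\<sigma> (\<tau> k) = k" if "k < n" for k
      using bij_betwE[OF bij\<tau>] that bij
      by (auto simp: \<tau>_def bij_betw_def intro!: f_the_inv_into_f)
    define c where "c k = \<tau> k div t" for k
    have "c k < 4" if "k < n" for k
      using \<tau>(1)[OF that] t n by (simp add: c_def less_mult_imp_div_less)
    moreover have "card {k. k < n \<and> c k = j} = t" if "j < 4" for j
    proof -
      have "bij_betw \<tau> {k. k < n \<and> c k = j} {k. k < n \<and> k div t = j}"
        by (rule bij_betw_subset[OF bij\<tau>, THEN bij_betw_cong[THEN iffD1, rotated]])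
          (use bij\<tau> in \<open>auto simp: c_def bij_betw_def\<close>)
      then show ?thesis using card_div_fibre[OF t that] n by (simp add: bij_betw_same_card)
    qed
    moreover have "A $$ (k, l) = P4star $$ (c k, c l)" if "k < n" "l < n" for k l
      using \<sigma>[OF \<tau>(1)[OF that(1)] \<tau>(1)[OF that(2)]] \<tau> that bl n by (simp add: c_def)
    ultimately show "n = 4 * t \<and> (\<exists>c. ?R c)" using n by blast
  }
  assume "n = 4 * t \<and> (\<exists>c. ?R c)"
  then obtain c where n: "n = 4 * t" and c: "?R c" by blast
  have "card {k. k < n \<and> c k = j} = card {k. k < n \<and> k div t = j}" for j
  proof (cases "j < 4")
    case True
    then show ?thesis using c card_div_fibre[OF t True] n by simp
  next
    case False
    then have "{k. k < n \<and> c k = j} = {}" "{k. k < n \<and> k div t = j} = {}"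
      using c n less_mult_imp_div_less[of _ 4 t] by auto
    then show ?thesis by (simp only: card.empty)
  qed
  then obtain \<sigma> where \<sigma>: "bij_betw \<sigma> {..<n} {..<n}" "\<And>k. k < n \<Longrightarrow> c (\<sigma> k) = k div t"
    using equal_fibres_bij[of n c "\<lambda>k. k div t"] by blast
  have "A $$ (\<sigma> i, \<sigma> j) = blowup P4star t $$ (i, j)" if "i < n" "j < n" for i j
    using c \<sigma> that bij_betwE[OF \<sigma>(1)] bl n by simp
  then show ?L unfolding graph_iso_def using A \<sigma>(1) n by (auto simp: blowup_def dim)
qed


section \<open>The gap of a graph\<close>

lemma adj01_spectral_decomposition:
  assumes "adj01 n A"
  obtains u where "spectral_decomposition n (\<lambda>k l. A $$ (k, l)) (\<lambda>i. eigs A ! i) u"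
proof -
  have A: "A \<in> carrier_mat n n" and sym: "A = transpose_mat A" using assms by (auto simp: adj01_def)
  obtain u where u:
    "\<And>i j. i < n \<Longrightarrow> j < n \<Longrightarrow> (\<Sum>k<n. u k i * u k j) = (if i = j then 1 else 0)"
    "\<And>k l. k < n \<Longrightarrow> l < n \<Longrightarrow> (\<Sum>i<n. u k i * u l i) = (if k = l then 1 else 0)"
    "\<And>k l. k < n \<Longrightarrow> l < n \<Longrightarrow> A $$ (k, l) = (\<Sum>i<n. eigs A ! i * u k i * u l i)"
    using symmetric_mat_spectral[OF A sym] by blast
  have "spectral_decomposition n (\<lambda>k l. A $$ (k, l)) (\<lambda>i. eigs A ! i) u"
    by unfold_locales
      (use u eigs_antimono[of _ _ A] symmetric_mat_char_poly_eigs(2)[OF A sym] in auto)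
  then show ?thesis by (rule that)
qed

lemma adj01_graph_spectrum:
  assumes "adj01 n A" "n \<ge> 3"
  obtains u where "graph_spectrum n (\<lambda>k l. A $$ (k, l)) (\<lambda>i. eigs A ! i) u"
proof -
  obtain u where "spectral_decomposition n (\<lambda>k l. A $$ (k, l)) (\<lambda>i. eigs A ! i) u"
    using adj01_spectral_decomposition[OF assms(1)] .
  then have "graph_spectrum n (\<lambda>k l. A $$ (k, l)) (\<lambda>i. eigs A ! i) u"
    by (intro graph_spectrum.intro graph_spectrum_axioms.intro)
      (use assms in \<open>auto simp: adj01_def\<close>)
  then show ?thesis by (rule that)
qed

lemma eig_gap_le:
  assumes "adj01 n A" "n \<ge> 2"
  shows "eig A 2 - eig A n \<le> n / sqrt 2"
\<comment> \<open>For two vertices \<open>\<lambda>\<^sub>2\<close> and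
  \<open>\<lambda>\<^sub>n\<close> coincide and the gap is zero.\<close>
proof (cases "n = 2")
  case False
  with assms obtain u where "graph_spectrum n (\<lambda>k l. A $$ (k, l)) (\<lambda>i. eigs A ! i) u"
    using adj01_graph_spectrum by (metis le_antisym not_less_eq_eq numeral_2_eq_2 numeral_3_eq_3)
  then show ?thesis using graph_spectrum.gap_le by (fastforce simp: eig_def)
qed simp

lemma eig_gap_extremal_imp_blowup:
  assumes "adj01 n A" "n \<ge> 2" and eq: "eig A 2 - eig A n = n / sqrt 2"
  shows "\<exists>t>0. graph_iso n A (blowup P4star t)"
proof -
  have "n \<noteq> 2" using eq by auto
  with assms obtain u where "graph_spectrum n (\<lambda>k l. A $$ (k, l)) (\<lambda>i. eigs A ! i) u"
    using adj01_graph_spectrum by (metis le_antisym not_less_eq_eq numeral_2_eq_2 numeral_3_eq_3)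
  then interpret graph_spectrum n "\<lambda>k l. A $$ (k, l)" "\<lambda>i. eigs A ! i" u .
  have eq': "eigs A ! 1 - eigs A ! (n - 1) = n / sqrt 2" using eq by (simp add: eig_def)
  note form = extremal_form[OF eq']
  define f where "f k = n / sqrt 2 * (u k 1 + u k (n - 1))" for k
  define g where "g k = u k 1 - u k (n - 1)" for k
  have b: "(f k * g l + g k * f l) / 2 = 2 * A $$ (k, l) - 1" if "k < n" "l < n" for k l
  proof -
    have "((m * (x + y)) * (x' - y') + (x - y) * (m * (x' + y'))) / 2 = m * (x * x' - y * y')"
      for m x y x' y' :: real by (simp add: field_simps)
    then show ?thesis unfolding form(1)[OF that] f_def g_def .
  qed
  have "\<exists>t c. t > 0 \<and> n = 4 * t \<and> (\<forall>k<n. c k < 4) \<and> (\<forall>j<4. card {k. k < n \<and> c k = j} = t) \<and>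
    (\<forall>k<n. \<forall>l<n. (f k * g l + g k * f l) / 2 = 2 * P4star $$ (c k, c l) - 1)"
  proof (rule sign_matrix_rank_two)
    show "n > 0" using n_ge_3 by simp
    show "(f k * g l + g k * f l) / 2 = 1 \<or> (f k * g l + g k * f l) / 2 = -1" if "k < n" "l < n" for k l
      unfolding b[OF that] using entries[OF that] by auto
    show "(\<Sum>k<n. f k) = 0"
      unfolding f_def sum_distrib_left[symmetric] sum.distrib form(2,3) by simp
    show "(\<Sum>k<n. g k) = 0"
      unfolding g_def sum_subtractf form(2,3) by simp
    have "(\<Sum>k<n. f k * g k) = n / sqrt 2 * ((\<Sum>k<n. u k 1 * u k 1) - (\<Sum>k<n. u k (n - 1) * u k (n - 1)))"
      unfolding f_def g_def sum_subtractf[symmetric] sum_distrib_left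
      by (intro sum.cong refl) (simp add: field_simps)
    then show "(\<Sum>k<n. f k * g k) = 0"
      using cols_orthonormal[of 1 1] cols_orthonormal[of "n - 1" "n - 1"] n_ge_3 by simp
  qed
  then obtain t c where t: "t > 0" "n = 4 * t"
    and c: "\<forall>k<n. c k < 4" "\<forall>j<4. card {k. k < n \<and> c k = j} = t"
    and cc: "\<And>k l. k < n \<Longrightarrow> l < n \<Longrightarrow> (f k * g l + g k * f l) / 2 = 2 * P4star $$ (c k, c l) - 1"
    by blast
  have "A $$ (k, l) = P4star $$ (c k, c l)" if "k < n" "l < n" for k l
    using cc[OF that] b[OF that] by simp
  moreover have "A \<in> carrier_mat n n" using assms(1) by (simp add: adj01_def)
  ultimately show ?thesis using graph_iso_blowup_P4star_iff[of A n t] t c by blast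
qed

section \<open>Lower bounds for the gap of blowups of \<open>P4star\<close>\<close>

lemma sum_fibres:
  fixes h :: "nat \<Rightarrow> real" and c :: "nat \<Rightarrow> nat" and n m t :: nat
  assumes "\<And>j. j < m \<Longrightarrow> card {k. k < n \<and> c k = j} = t"
  shows "(\<Sum>k<n. if c k < m then h (c k) else 0) = t * (\<Sum>j<m. h j)"
proof -
  have "(\<Sum>k<n. if c k < m then h (c k) else 0) = (\<Sum>k<n. \<Sum>j<m. if c k = j then h j else 0)"
    by (intro sum.cong refl) simp
  also have "\<dots> = (\<Sum>j<m. \<Sum>k<n. if c k = j then h j else 0)" by (rule sum.swap)
  also have "\<dots> = (\<Sum>j<m. t * h j)"
  proof (intro sum.cong refl)
    fix j assume "j \<in> {..<m}"
    then show "(\<Sum>k<n. if c k = j then h j else 0) = t * h j"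
      using assms sum.inter_filter[of "{..<n}" "\<lambda>_. h j" "\<lambda>k. c k = j", OF finite_lessThan] by simp
  qed
  finally show ?thesis by (simp add: sum_distrib_left)
qed

text \<open>
  Vertices of colour at least 4 are isolated; \<open>d\<close> is the number of loops that were deleted
  at each vertex.
\<close>
lemma P4star_blowup_gap:
  fixes d :: "nat \<Rightarrow> real"
  assumes A: "adj01 n A" and t: "t > 0" and n: "n \<ge> 2"
    and fib: "\<And>j. j < 4 \<Longrightarrow> card {k. k < n \<and> c k = j} = t"
    and entry: "\<And>k l. k < n \<Longrightarrow> l < n \<Longrightarrow>
      A $$ (k, l) = (if c k < 4 \<and> c l < 4 then P4star $$ (c k, c l) else 0) - (if k = l then d k else 0)"
    and d: "\<And>k. k < n \<Longrightarrow> 0 \<le> d k \<and> d k \<le> \<delta>"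
  shows "eig A 2 - eig A n \<ge> 2 * sqrt 2 * t - \<delta>"
proof -
  obtain u where "spectral_decomposition n (\<lambda>k l. A $$ (k, l)) (\<lambda>i. eigs A ! i) u"
    using adj01_spectral_decomposition[OF A] .
  then interpret spectral_decomposition n "\<lambda>k l. A $$ (k, l)" "\<lambda>i. eigs A ! i" u .
  \<comment> \<open>\<open>ext z\<close> spreads a vector on the path over the colour classes and is
    zero elsewhere; \<open>q\<close> and \<open>r\<close> are the quadratic form of
    \<open>P4star\<close> and the squared norm.\<close>
  define ext where "ext z k = (if c k < 4 then z (c k) else 0)" for z :: "nat \<Rightarrow> real" and k
  define q where "q z = (z 0)\<^sup>2 + (z 3)\<^sup>2 + 2 * z 0 * z 1 + 2 * z 1 * z 2 + 2 * z 2 * z 3" for z :: "nat \<Rightarrow> real"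
  define r where "r z = (z 0)\<^sup>2 + (z 1)\<^sup>2 + (z 2)\<^sup>2 + (z 3)\<^sup>2" for z :: "nat \<Rightarrow> real"
  have sum4: "(\<Sum>j<4. h j) = h 0 + h 1 + h 2 + h 3" for h :: "nat \<Rightarrow> real"
    by (simp add: eval_nat_numeral)
  have norm_ext: "(\<Sum>k<n. (ext z k)\<^sup>2) = t * r z" for z
  proof -
    have "(\<Sum>k<n. (ext z k)\<^sup>2) = (\<Sum>k<n. if c k < 4 then (z (c k))\<^sup>2 else 0)"
      by (intro sum.cong refl) (simp add: ext_def)
    also have "\<dots> = t * (\<Sum>j<4. (z j)\<^sup>2)" by (rule sum_fibres[OF fib])
    finally show ?thesis by (simp add: sum4 r_def)
  qed
  have quad_ext: "quad (ext z) = t * (t * q z) - (\<Sum>k<n. d k * (ext z k)\<^sup>2)" for z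
  proof -
    let ?p = "\<lambda>i j. P4star $$ (i, j) * z i * z j"
    have "quad (ext z) = (\<Sum>k<n. \<Sum>l<n. (if c k < 4 then if c l < 4 then ?p (c k) (c l) else 0 else 0)
        - (if k = l then d k * (ext z k)\<^sup>2 else 0))"
      unfolding quad_def
      by (intro sum.cong refl) (auto simp: entry ext_def algebra_simps power2_eq_square)
    also have "\<dots> = (\<Sum>k<n. if c k < 4 then t * (\<Sum>j<4. ?p (c k) j) else 0) - (\<Sum>k<n. d k * (ext z k)\<^sup>2)"
      unfolding sum_subtractf
    proof (intro arg_cong2[of _ _ _ _ "(-)"] sum.cong refl)
      fix k
      show "(\<Sum>l<n. if c k < 4 then if c l < 4 then ?p (c k) (c l) else 0 else 0) =
          (if c k < 4 then t * (\<Sum>j<4. ?p (c k) j) else 0)"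
        using sum_fibres[OF fib, where h = "?p (c k)"] by simp
    next
      fix k assume "k \<in> {..<n}"
      then show "(\<Sum>l<n. if k = l then d k * (ext z k)\<^sup>2 else 0) = d k * (ext z k)\<^sup>2" by simp
    qed
    also have "(\<Sum>k<n. if c k < 4 then t * (\<Sum>j<4. ?p (c k) j) else 0) = t * (\<Sum>i<4. t * (\<Sum>j<4. ?p i j))"
      by (rule sum_fibres[OF fib])
    also have "(\<Sum>i<4. t * (\<Sum>j<4. ?p i j)) = t * q z"
      by (simp add: sum4 P4star_index q_def algebra_simps power2_eq_square)
    finally show ?thesis .
  qed
  have dsum: "0 \<le> (\<Sum>k<n. d k * (ext z k)\<^sup>2)" "(\<Sum>k<n. d k * (ext z k)\<^sup>2) \<le> \<delta> * (t * r z)" for z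
  proof -
    show "0 \<le> (\<Sum>k<n. d k * (ext z k)\<^sup>2)" using d by (intro sum_nonneg) simp
    have "(\<Sum>k<n. d k * (ext z k)\<^sup>2) \<le> (\<Sum>k<n. \<delta> * (ext z k)\<^sup>2)"
      using d by (intro sum_mono mult_right_mono) auto
    then show "(\<Sum>k<n. d k * (ext z k)\<^sup>2) \<le> \<delta> * (t * r z)"
      by (simp add: norm_ext flip: sum_distrib_left)
  qed
  have s2: "sqrt 2 * sqrt 2 = (2::real)" by simp
  have "eigs A ! (n - 1) \<le> - sqrt 2 * t"
  proof (rule last_eigenvalue_le)
    \<comment> \<open>An eigenvector of \<open>P4star\<close> for its least eigenvalue
      \<open>- sqrt 2\<close>. Deleting loops only lowers the form, so no correction by
      \<open>\<delta>\<close> arises here.\<close>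
    define z where "z = (\<lambda>i::nat. if i = 0 then 1 else if i = 1 then - (1 + sqrt 2)
      else if i = 2 then 1 + sqrt 2 else - 1 :: real)"
    have z: "q z = - sqrt 2 * r z" "r z > 0"
      using s2 by (simp_all add: q_def r_def z_def power2_eq_square algebra_simps add_pos_pos)
    have "quad (ext z) \<le> t * (t * q z)" using quad_ext dsum(1) by simp
    then show "quad (ext z) \<le> - sqrt 2 * t * (\<Sum>k<n. (ext z k)\<^sup>2)"
      by (simp add: norm_ext z(1) mult_ac)
    show "(\<Sum>k<n. (ext z k)\<^sup>2) > 0" using z(2) t by (simp add: norm_ext)
  qed
  moreover have "eigs A ! 1 \<ge> sqrt 2 * t - \<delta>"
  proof (rule second_eigenvalue_ge[OF n])
    \<comment> \<open>The test plane is spanned by the eigenvectors of \<open>P4star\<close> for 2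
      and \<open>sqrt 2\<close>, namely the constant vector and \<open>y\<close>. They are
      orthogonal, so no mixed terms occur in \<open>r w\<close> and \<open>q w\<close>. Deleted
      loops cost at most \<open>\<delta>\<close>.\<close>
    define s where "s = sqrt 2 - 1"
    define y where "y = (\<lambda>i::nat. if i = 0 then 1 else if i = 1 then s else if i = 2 then - s else - 1 :: real)"
    fix \<alpha> \<beta> :: real
    define w where "w = (\<lambda>i. \<alpha> * 1 + \<beta> * y i)"
    have w: "(\<lambda>k. \<alpha> * ext (\<lambda>_. 1) k + \<beta> * ext y k) = ext w"
      by (auto simp: ext_def w_def)
    have ss: "s * s = 1 - 2 * s" using s2 by (simp add: s_def algebra_simps)
    have r: "r w = 4 * \<alpha>\<^sup>2 + (2 + 2 * s\<^sup>2) * \<beta>\<^sup>2"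
      by (simp add: r_def w_def y_def power2_eq_square algebra_simps)
    have q: "q w = 8 * \<alpha>\<^sup>2 + sqrt 2 * ((2 + 2 * s\<^sup>2) * \<beta>\<^sup>2)"
    proof -
      have "q w = 8 * \<alpha>\<^sup>2 + (2 + 4 * s - 2 * s\<^sup>2) * \<beta>\<^sup>2"
        by (simp add: q_def w_def y_def power2_eq_square algebra_simps)
      moreover have "2 + 4 * s - 2 * s\<^sup>2 = sqrt 2 * (2 + 2 * s\<^sup>2)"
        using s2 by (simp add: s_def power2_eq_square algebra_simps)
      ultimately show ?thesis by (simp add: mult_ac)
    qed
    have "sqrt 2 * 4 \<le> (8::real)" using real_sqrt_le_mono[of 2 4] by simp
    then have "sqrt 2 * 4 * \<alpha>\<^sup>2 \<le> 8 * \<alpha>\<^sup>2" by (rule mult_right_mono) simp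
    then have qr: "sqrt 2 * r w \<le> q w" unfolding q r by (simp add: algebra_simps)
    have "(sqrt 2 * t - \<delta>) * (t * r w) = t * (t * (sqrt 2 * r w)) - \<delta> * (t * r w)"
      by (simp add: algebra_simps)
    also have "\<dots> \<le> t * (t * q w) - \<delta> * (t * r w)"
      using qr by (simp add: mult_left_mono)
    also have "\<dots> \<le> quad (ext w)" unfolding quad_ext using dsum(2)[of w] by simp
    finally show "(sqrt 2 * t - \<delta>) * (\<Sum>k<n. (\<alpha> * ext (\<lambda>_. 1) k + \<beta> * ext y k)\<^sup>2)
        \<le> quad (\<lambda>k. \<alpha> * ext (\<lambda>_. 1) k + \<beta> * ext y k)"
      by (simp add: w norm_ext fun_cong[OF w])
    assume "(\<Sum>k<n. (\<alpha> * ext (\<lambda>_. 1) k + \<beta> * ext y k)\<^sup>2) = 0"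
    then have "r w = 0" using t by (simp add: fun_cong[OF w] norm_ext)
    moreover have "(2 + 2 * s\<^sup>2) * \<beta>\<^sup>2 \<ge> 0" by simp
    ultimately have "\<alpha>\<^sup>2 = 0" "(2 + 2 * s\<^sup>2) * \<beta>\<^sup>2 = 0" unfolding r
      by (smt (verit) zero_le_power2)+
    moreover have "2 + 2 * s\<^sup>2 > 0" by (simp add: add_pos_nonneg)
    ultimately show "\<alpha> = 0 \<and> \<beta> = 0" by simp
  qed
  ultimately show ?thesis by (simp add: eig_def)
qed

text \<open>No loop is deleted, so the lower bound with \<open>\<delta> = 0\<close> meets the
  general upper bound.\<close>

lemma blowup_imp_eig_gap_extremal:
  assumes A: "adj01 n A" and n: "n \<ge> 2" and t: "t > 0" and iso: "graph_iso n A (blowup P4star t)"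
  shows "eig A 2 - eig A n = n / sqrt 2"
proof -
  have carrier: "A \<in> carrier_mat n n" using A by (simp add: adj01_def)
  obtain c where n4: "n = 4 * t" and c: "\<forall>k<n. c k < 4" "\<forall>j<4. card {k. k < n \<and> c k = j} = t"
    "\<forall>k<n. \<forall>l<n. A $$ (k, l) = P4star $$ (c k, c l)"
    using iso unfolding graph_iso_blowup_P4star_iff[OF carrier t] by blast
  have "eig A 2 - eig A n \<ge> 2 * sqrt 2 * t - 0"
    by (rule P4star_blowup_gap[OF A t n, where c = c and d = "\<lambda>_. 0"]) (use c in auto)
  moreover have "n / sqrt 2 = 2 * sqrt 2 * t" by (simp add: n4 field_simps)
  ultimately show ?thesis using eig_gap_le[OF A n] by simp
qed

section \<open>The maximum spread of simple graphs and its limit\<close>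

lemma finite_spreads: "finite {spread i j n A | A. simple_adj n A}"
proof -
  have "{spread i j n A | A. simple_adj n A} \<subseteq>
      (\<lambda>f. spread i j n (mat n n f)) ` (({..<n} \<times> {..<n}) \<rightarrow>\<^sub>E {0, 1})"
  proof
    fix s assume "s \<in> {spread i j n A | A. simple_adj n A}"
    then obtain A where s: "s = spread i j n A" and A: "A \<in> carrier_mat n n"
      and e: "\<forall>i<n. \<forall>j<n. A $$ (i, j) = 0 \<or> A $$ (i, j) = 1"
      by (auto simp: simple_adj_def adj01_def)
    \<comment> \<open>A matrix is recovered from its entries in range, so the spreads lie in the
      image of a finite set of functions; this lets \<open>Max\<close> be compared with its
      elements.\<close>
    let ?f = "restrict (($$) A) ({..<n} \<times> {..<n})"
    have "A = mat n n ?f" by (rule eq_matI) (use A in auto)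
    then have "s = spread i j n (mat n n ?f)" unfolding s by (rule arg_cong)
    moreover have "?f \<in> ({..<n} \<times> {..<n}) \<rightarrow>\<^sub>E {0, 1}" using e by auto
    ultimately show "s \<in> (\<lambda>f. spread i j n (mat n n f)) ` (({..<n} \<times> {..<n}) \<rightarrow>\<^sub>E {0, 1})"
      by (rule image_eqI)
  qed
  then show ?thesis by (rule finite_subset) (simp add: finite_PiE)
qed

lemma spread_1_0: "spread (Suc 0) 0 n A = eig A 2 - eig A n"
  by (simp add: spread_def numeral_2_eq_2)

lemma spread_max_le:
  assumes "n \<ge> 2"
  shows "spread_max 1 0 n \<le> n / sqrt 2"
proof -
  have "simple_adj n (0\<^sub>m n n)" by (auto simp: simple_adj_def adj01_def)
  then have "{spread 1 0 n A | A. simple_adj n A} \<noteq> {}" by blast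
  moreover have "spread 1 0 n A \<le> n / sqrt 2" if "simple_adj n A" for A
    using eig_gap_le[of n A] assms that by (simp add: spread_1_0 simple_adj_def)
  ultimately show ?thesis
    unfolding spread_max_def using finite_spreads by (subst Max_le_iff) auto
qed

lemma spread_max_ge:
  assumes "n \<ge> 4"
  shows "spread_max 1 0 n \<ge> 2 * sqrt 2 * (n div 4) - 1"
proof -
  define t where "t = n div 4"
  have t: "t > 0" and tn: "4 * t \<le> n" using assms by (auto simp: t_def)
  \<comment> \<open>The blowup with its loops, padded by the at most three vertices with
    \<open>k div t \<ge> 4\<close>, which are isolated. The diagonal \<open>p k k\<close> records
    the loops deleted in \<open>A\<close>.\<close>
  define p where "p k l = (if k div t < 4 \<and> l div t < 4 then P4star $$ (k div t, l div t) else 0)" for k l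
  define A where "A = mat n n (\<lambda>(k, l). if k = l then 0 else p k l)"
  have p01: "p k l = 0 \<or> p k l = 1" for k l by (simp add: p_def P4star_index)
  have psym: "p k l = p l k" for k l by (auto simp: p_def P4star_index)
  have A: "simple_adj n A"
    unfolding simple_adj_def adj01_def
  proof (intro conjI allI impI)
    show "A = transpose_mat A" by (rule eq_matI) (auto simp: A_def psym)
    show "A $$ (i, j) = 0 \<or> A $$ (i, j) = 1" if "i < n" "j < n" for i j
      using that p01 by (simp add: A_def)
  qed (auto simp: A_def)
  have "eig A 2 - eig A n \<ge> 2 * sqrt 2 * t - 1"
  proof (rule P4star_blowup_gap[where c = "\<lambda>k. k div t" and d = "\<lambda>k. p k k"])
    show "adj01 n A" using A by (simp add: simple_adj_def)
    show "t > 0" by (rule t)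
    show "n \<ge> 2" using assms by simp
    show "card {k. k < n \<and> k div t = j} = t" if "j < 4" for j
    proof -
      have "k < 4 * t" if "k div t = j" for k
        using div_less_iff_less_mult[OF t, of k 4] that \<open>j < 4\<close> by simp
      then have "{k. k < n \<and> k div t = j} = {k. k < 4 * t \<and> k div t = j}" using tn by fastforce
      then show ?thesis using card_div_fibre[OF t that] by simp
    qed
    show "A $$ (k, l) = (if k div t < 4 \<and> l div t < 4 then P4star $$ (k div t, l div t) else 0) -
        (if k = l then p k k else 0)" if "k < n" "l < n" for k l
      using that by (simp add: A_def p_def)
    show "0 \<le> p k k \<and> p k k \<le> 1" for k using p01[of k k] by auto
  qed
  moreover have "spread 1 0 n A \<le> spread_max 1 0 n"
    unfolding spread_max_def using finite_spreads A by (intro Max_ge) auto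
  ultimately show ?thesis by (simp add: spread_1_0 t_def)
qed

lemma spread_max_asymptotics: "(\<lambda>n. spread_max 1 0 n / n) \<longlonglongrightarrow> 1 / sqrt 2"
proof (rule tendsto_sandwich)
  show "\<forall>\<^sub>F n in sequentially. spread_max 1 0 n / n \<le> 1 / sqrt 2"
    using eventually_ge_at_top[of 2]
  proof eventually_elim
    case (elim n)
    then show ?case using spread_max_le[OF elim] by (simp add: field_simps)
  qed
  \<comment> \<open>The constant 4 covers the rounding loss of at most
    \<open>3 * sqrt 2 / 2 \<le> 3\<close> in the gap and the loss of 1 from deleting loops.\<close>
  show "\<forall>\<^sub>F n in sequentially. 1 / sqrt 2 - 4 * (1 / n) \<le> spread_max 1 0 n / n"
    using eventually_ge_at_top[of 4]
  proof eventually_elim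
    case (elim n)
    have "4 * real (n div 4) \<ge> real n - 3" by linarith
    moreover have "(sqrt 2 :: real) \<ge> 0" "(sqrt 2 :: real) \<le> 2" using real_sqrt_le_mono[of 2 4] by simp_all
    ultimately have "sqrt 2 * (real n - 3) \<le> sqrt 2 * (4 * real (n div 4))"
      by (intro mult_left_mono) auto
    then have "sqrt 2 / 2 * n - 4 \<le> 2 * sqrt 2 * (n div 4) - 1"
      using \<open>sqrt 2 \<le> 2\<close> by (simp add: algebra_simps)
    also note spread_max_ge[OF elim]
    finally have "(sqrt 2 / 2 * n - 4) / n \<le> spread_max 1 0 n / n"
      by (rule divide_right_mono) simp
    moreover have "1 / sqrt 2 = sqrt 2 / (2::real)" by (simp add: field_simps)
    then have "(sqrt 2 / 2 * n - 4) / n = 1 / sqrt 2 - 4 * (1 / n)"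
      using elim by (simp add: diff_divide_distrib)
    ultimately show ?case by simp
  qed
  have "(\<lambda>n. 1 / sqrt 2 - 4 * (1 / real n)) \<longlonglongrightarrow> 1 / sqrt 2 - 4 * 0"
    by (intro tendsto_intros lim_1_over_n)
  then show "(\<lambda>n. 1 / sqrt 2 - 4 * (1 / real n)) \<longlonglongrightarrow> 1 / sqrt 2" by simp
qed simp

theorem theorem1p4:
  shows "(\<forall>n::nat. \<forall>A. n \<ge> 2 \<longrightarrow> adj01 n A \<longrightarrow>
            eig A 2 - eig A n \<le> real n / sqrt 2 \<and>
            (eig A 2 - eig A n = real n / sqrt 2 \<longleftrightarrow>
               (\<exists>t::nat. t > 0 \<and> graph_iso n A (blowup P4star t))))
         \<and> (\<lambda>n. spread_max 1 0 n / real n) \<longlonglongrightarrow> 1 / sqrt 2"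
  using eig_gap_le eig_gap_extremal_imp_blowup blowup_imp_eig_gap_extremal spread_max_asymptotics
  by blast

end
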